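(* Let $n\ge 2$, let $x=(x_1,\dots,x_n)\in\mathbb{R}^n$ be arbitrary, let $l,h\in\mathbb{R}^n$, and let $L=(l_{ij})=lh^T+hl^T$. Let $A,B$ be the real $n\times n$ matrices with entries $a_{ij}=l_{ij}\cos(x_i-x_j)$ and $b_{ij}=l_{ij}\sin(x_i-x_j)$, and let $P=\begin{bmatrix} A & B \\ {} B^T & A \end{bmatrix}\in\mathbb{R}^{2n\times 2n}$. Put $\gamma=l^Th$ and $\delta=[(l^Tl)(h^Th)]^{1/2}$. If $\operatorname{rank}(L)=2$, then the nonzero eigenvalues of $P$, listed with multiplicity, are $\lambda_{1}=\lambda_2=\gamma+\delta$ and $\lambda_{3}=\lambda_4=\gamma-\delta$, and the remaining $2n-4$ eigenvalues of $P$ are zero.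
   Context: Here $l_{ij}$ denotes the $(i,j)$ entry of the matrix $L$, i.e. $l_{ij}=l_ih_j+h_il_j$, where $l_i,h_i$ are the components of the vectors $l,h$. The matrix $P$ is real symmetric. *)

theory Defs
  imports
    Complex_Main
    "HOL-Library.Multiset"
    "Jordan_Normal_Form.Matrix"
    "Jordan_Normal_Form.Char_Poly"
    "Jordan_Normal_Form.DL_Rank"
begin

(* Algebraic multiplicities. Only roots in 'a are counted, so all eigenvalues lie in 'a
   exactly when the size of the multiset is the dimension of the matrix. For real symmetric
   matrices this is the case, and algebraic and geometric multiplicities agree. *)
definition eigenvalues_mset :: "'a :: field mat \<Rightarrow> 'a multiset" where
  "eigenvalues_mset M = proots (char_poly M)"

lemma set_eigenvalues_mset:
  assumes "M \<in> carrier_mat n n"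
  shows "set_mset (eigenvalues_mset M) = {k. eigenvalue M k}"
proof -
  have "char_poly M \<noteq> 0"
    using degree_monic_char_poly[OF assms] by auto
  then show ?thesis
    by (simp add: eigenvalues_mset_def eigenvalue_root_char_poly[OF assms])
qed

definition outer_prod :: "'a :: semiring_0 vec \<Rightarrow> 'a vec \<Rightarrow> 'a mat" where
  "outer_prod u v = mat_of_cols (dim_vec u) [u] * (mat_of_cols (dim_vec v) [v])\<^sup>T"

lemma outer_prod_carrier [simp]:
  assumes "u \<in> carrier_vec n" "v \<in> carrier_vec m"
  shows "outer_prod u v \<in> carrier_mat n m"
  using assms by (auto simp: outer_prod_def intro!: mult_carrier_mat[of _ _ 1])

lemma index_outer_prod [simp]:
  assumes "i < dim_vec u" "j < dim_vec v"
  shows "outer_prod u v $$ (i, j) = u $ i * v $ j"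
  using assms by (simp add: outer_prod_def scalar_prod_def mat_of_cols_index)

end

theory Submission
  imports Defs
begin

text \<open>Cutting \<open>P\<close> into the \<open>2 \<times> 2\<close> blocks with row indices \<open>i, n + i\<close> and column indices \<open>j, n + j\<close>
  gives \<open>l\<^sub>i\<^sub>j\<close> times the rotation by \<open>x\<^sub>i - x\<^sub>j\<close>. Hence \<open>P\<close> is orthogonally similar to
  \<open>diag(L, L)\<close>. Since \<open>L = U W\<close> with \<open>U = [l h]\<close> and \<open>W = [h l]\<^sup>T\<close>, its characteristic
  polynomial is \<open>X\<^sup>n\<^sup>-\<^sup>2\<close> times that of the \<open>2 \<times> 2\<close> matrix \<open>W U\<close>, whose roots are
  \<open>\<gamma> \<plusminus> \<delta>\<close>. One of these vanishes only in the equality case of Cauchy--Schwarz, where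
  \<open>l\<close> and \<open>h\<close> are dependent and \<open>L\<close> has rank at most 1.\<close>

text \<open>The characteristic matrix keeps the zero block, so its determinant over the polynomials
  factors. Applied below to \<open>diag(L, L)\<close>.\<close>

lemma char_poly_four_block_lower_left_zero:
  fixes A :: "'a :: idom mat"
  assumes A: "A \<in> carrier_mat n n" and B: "B \<in> carrier_mat n m" and D: "D \<in> carrier_mat m m"
  shows "char_poly (four_block_mat A B (0\<^sub>m m n) D) = char_poly A * char_poly D"
proof -
  have "char_poly_matrix (four_block_mat A B (0\<^sub>m m n) D) =
    four_block_mat (char_poly_matrix A) (map_mat (\<lambda>a. [:- a:]) B) (0\<^sub>m m n) (char_poly_matrix D)"
    by (rule eq_matI) (use A B D in \<open>auto simp: char_poly_matrix_def\<close>)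
  then show ?thesis
    unfolding char_poly_def
    by (simp add: det_four_block_mat_lower_left_zero[where n = n and m = m] A B D)
qed

lemma char_poly_four_block_upper_right_zero:
  fixes A :: "'a :: idom mat"
  assumes A: "A \<in> carrier_mat n n" and C: "C \<in> carrier_mat m n" and D: "D \<in> carrier_mat m m"
  shows "char_poly (four_block_mat A (0\<^sub>m n m) C D) = char_poly A * char_poly D"
proof -
  have "char_poly_matrix (four_block_mat A (0\<^sub>m n m) C D) =
    four_block_mat (char_poly_matrix A) (0\<^sub>m n m) (map_mat (\<lambda>a. [:- a:]) C) (char_poly_matrix D)"
    by (rule eq_matI) (use A C D in \<open>auto simp: char_poly_matrix_def\<close>)
  then show ?thesis
    unfolding char_poly_def
    by (simp add: det_four_block_mat_upper_right_zero[where n = n and m = m] A C D)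
qed

lemma char_poly_zero_mat: "char_poly (0\<^sub>m n n :: 'a :: idom mat) = [:0, 1:] ^ n"
proof -
  have "upper_triangular (0\<^sub>m n n :: 'a mat)" by auto
  then have "char_poly (0\<^sub>m n n :: 'a mat) = (\<Prod>a\<leftarrow>diag_mat (0\<^sub>m n n :: 'a mat). [:- a, 1:])"
    by (rule char_poly_upper_triangular[OF zero_carrier_mat])
  also have "diag_mat (0\<^sub>m n n :: 'a mat) = replicate n 0"
    by (rule nth_equalityI) (auto simp: diag_mat_def)
  finally show ?thesis by simp
qed

text \<open>Both block matrices \<open>[U W, 0; W, 0]\<close> and \<open>[0, 0; W, W U]\<close> are conjugate via \<open>[1, U; 0, 1]\<close>.\<close>
lemma char_poly_mult_swap:
  fixes U :: "'a :: idom mat"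
  assumes U: "U \<in> carrier_mat n m" and W: "W \<in> carrier_mat m n"
  shows "char_poly (U * W) * [:0, 1:] ^ m = [:0, 1:] ^ n * char_poly (W * U)"
proof -
  let ?F = "four_block_mat (U * W) (0\<^sub>m n m) W (0\<^sub>m m m)"
  let ?G = "four_block_mat (0\<^sub>m n n) (0\<^sub>m n m) W (W * U)"
  let ?S = "four_block_mat (1\<^sub>m n) U (0\<^sub>m m n) (1\<^sub>m m)"
  let ?T = "four_block_mat (1\<^sub>m n) (- U) (0\<^sub>m m n) (1\<^sub>m m)"
  note mult = mult_four_block_mat[where ?nr1.0 = n and ?n1.0 = n and ?n2.0 = m and ?nr2.0 = m
      and ?nc1.0 = n and ?nc2.0 = m]
  have UW: "U * W \<in> carrier_mat n n" and WU: "W * U \<in> carrier_mat m m"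
    using U W by auto
  have uminus_zero: "- 0\<^sub>m m m = (0\<^sub>m m m :: 'a mat)" by (rule eq_matI) auto
  have U_minus: "U + - U = 0\<^sub>m n m" "- U + U = 0\<^sub>m n m" by (rule eq_matI; use U in auto)+
  have ST: "?S * ?T = 1\<^sub>m (n + m)"
    by (subst mult) (use U in \<open>auto simp: uminus_zero U_minus\<close>)
  have TS: "?T * ?S = 1\<^sub>m (n + m)"
    by (subst mult) (use U in \<open>auto simp: U_minus\<close>)
  have "?S * ?G = four_block_mat (U * W) (U * (W * U)) W (W * U)"
    by (subst mult) (use U W UW WU in auto)
  also have "\<dots> * ?T = ?F"
    by (subst mult) (use U W UW WU in \<open>auto simp: assoc_mult_mat[OF U W U]\<close>)
  finally have "?F = ?S * ?G * ?T" ..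
  then have "similar_mat_wit ?F ?G ?S ?T"
    by (intro similar_mat_witI[OF ST TS]) (use U W in auto)
  then have "char_poly ?F = char_poly ?G"
    by (intro char_poly_similar) (unfold similar_mat_def, blast)
  \<comment> \<open>Both matrices are block triangular: the zero block of size \<open>m\<close> in
    \<open>?F\<close> contributes \<open>X^m\<close>, and the one of size \<open>n\<close> in
    \<open>?G\<close> contributes \<open>X^n\<close>.\<close>
  then show ?thesis
    by (simp add: char_poly_four_block_upper_right_zero[where n = n and m = m] U W UW WU
        char_poly_zero_mat)
qed

text \<open>The block formula \<open>det (A D - B C)\<close> relies on commuting blocks, which is
  automatic for blocks of size 1.\<close>

lemma det_four_block_mat_1_1:
  fixes a b c d :: "'a :: idom"
  shows "det (four_block_mat (mat 1 1 (\<lambda>_. a)) (mat 1 1 (\<lambda>_. b)) (mat 1 1 (\<lambda>_. c)) (mat 1 1 (\<lambda>_. d)))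
    = a * d - b * c"
proof -
  have "det (four_block_mat (mat 1 1 (\<lambda>_. a)) (mat 1 1 (\<lambda>_. b)) (mat 1 1 (\<lambda>_. c)) (mat 1 1 (\<lambda>_. d)))
    = det (mat 1 1 (\<lambda>_. a) * mat 1 1 (\<lambda>_. d) - mat 1 1 (\<lambda>_. b) * mat 1 1 (\<lambda>_. c))"
    by (rule det_four_block_mat[where n = 1])
      (auto simp: scalar_prod_def mult.commute intro!: eq_matI)
  also have "\<dots> = a * d - b * c"
    by (subst det_single) (auto simp: scalar_prod_def)
  finally show ?thesis .
qed

lemma char_poly_2_2:
  fixes M :: "'a :: idom mat"
  assumes M: "M \<in> carrier_mat 2 2"
  shows "char_poly M = [:- M $$ (0, 0), 1:] * [:- M $$ (1, 1), 1:]
    - [:- M $$ (0, 1):] * [:- M $$ (1, 0):]"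
proof -
  have "char_poly_matrix M = four_block_mat (mat 1 1 (\<lambda>_. [:- M $$ (0, 0), 1:]))
      (mat 1 1 (\<lambda>_. [:- M $$ (0, 1):])) (mat 1 1 (\<lambda>_. [:- M $$ (1, 0):]))
      (mat 1 1 (\<lambda>_. [:- M $$ (1, 1), 1:]))"
    by (rule eq_matI) (use M in \<open>auto simp: char_poly_matrix_def numeral_2_eq_2 less_Suc_eq\<close>)
  then show ?thesis
    unfolding char_poly_def by (simp only: det_four_block_mat_1_1)
qed

lemma dim_outer_prod [simp]:
  "dim_row (outer_prod u v) = dim_vec u" "dim_col (outer_prod u v) = dim_vec v"
  by (simp_all add: outer_prod_def)

lemma index_sym_outer_prod:
  assumes "l \<in> carrier_vec n" "h \<in> carrier_vec n" "i < n" "j < n"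
  shows "(outer_prod l h + outer_prod h l) $$ (i, j) = l $ i * h $ j + h $ i * l $ j"
  using assms by auto

lemma scalar_prod_ge_0_real:
  fixes v :: "real vec"
  shows "0 \<le> v \<bullet> v"
  by (simp add: scalar_prod_def sum_nonneg)

text \<open>The matrix \<open>W U\<close> has both diagonal entries \<gamma> and off-diagonal
  entries \<open>h \<bullet> h\<close> and \<open>l \<bullet> l\<close>, so its characteristic
  polynomial is \<open>(X - \<gamma>)^2 - \<delta>^2\<close>, a difference of squares.\<close>

lemma char_poly_sym_outer_prod:
  fixes l h :: "real vec"
  assumes l: "l \<in> carrier_vec n" and h: "h \<in> carrier_vec n" and n: "n \<ge> 2"
  defines "\<gamma> \<equiv> l \<bullet> h" and "\<delta> \<equiv> sqrt ((l \<bullet> l) * (h \<bullet> h))"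
  shows "char_poly (outer_prod l h + outer_prod h l) =
    [:0, 1:] ^ (n - 2) * ([:- (\<gamma> + \<delta>), 1:] * [:- (\<gamma> - \<delta>), 1:])"
proof -
  define U where "U = mat_of_cols n [l, h]"
  define W where "W = mat_of_rows n [h, l]"
  have U: "U \<in> carrier_mat n 2" and W: "W \<in> carrier_mat 2 n"
    by (auto simp: U_def W_def)
  have L: "outer_prod l h + outer_prod h l = U * W"
    by (rule eq_matI)
      (use l h outer_prod_carrier[OF l h] outer_prod_carrier[OF h l] in
        \<open>auto simp: U_def W_def scalar_prod_def mat_of_cols_index mat_of_rows_index
           numeral_2_eq_2 outer_prod_def\<close>)
  have rows: "row W 0 = h" "row W (Suc 0) = l" and cols: "col U 0 = l" "col U (Suc 0) = h"
    using l h by (auto simp: U_def W_def)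
  have \<delta>: "\<delta> * \<delta> = (l \<bullet> l) * (h \<bullet> h)"
    by (simp add: \<delta>_def scalar_prod_ge_0_real)
  have "char_poly (W * U) = [:- \<gamma>, 1:] * [:- \<gamma>, 1:] - [:- (h \<bullet> h):] * [:- (l \<bullet> l):]"
    using comm_scalar_prod[OF l h]
    by (subst char_poly_2_2) (use U W in \<open>auto simp: rows cols \<gamma>_def\<close>)
  also have "\<dots> = [:- (\<gamma> + \<delta>), 1:] * [:- (\<gamma> - \<delta>), 1:]"
    using \<delta> by (simp add: algebra_simps)
  finally have "char_poly (U * W) * [:0, 1:] ^ 2 =
      [:0, 1:] ^ n * ([:- (\<gamma> + \<delta>), 1:] * [:- (\<gamma> - \<delta>), 1:])"
    using char_poly_mult_swap[OF U W] by simp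
  \<comment> \<open>As \<open>n \<ge> 2\<close>, the factor \<open>X^2\<close> can be split off and
    then cancelled on both sides.\<close>
  moreover have "[:0, 1 :: real:] ^ n = [:0, 1:] ^ (n - 2) * [:0, 1:] ^ 2"
    using n by (simp only: power_add[symmetric] le_add_diff_inverse2)
  ultimately have "char_poly (U * W) * [:0, 1:] ^ 2 =
      ([:0, 1:] ^ (n - 2) * ([:- (\<gamma> + \<delta>), 1:] * [:- (\<gamma> - \<delta>), 1:])) * [:0, 1:] ^ 2"
    by (simp only: ac_simps)
  then show ?thesis
    unfolding L by (subst (asm) mult_right_cancel) simp_all
qed

text \<open>In the equality case of Cauchy--Schwarz either \<open>l = 0\<close> or \<open>h\<close>
  is a multiple of \<open>l\<close>. Either way the entries have the product form
  \<open>c * l $ i * l $ j\<close>, which bounds the rank by 1.\<close>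

lemma rank_sym_outer_prod_le_1:
  fixes l h :: "real vec"
  assumes l: "l \<in> carrier_vec n" and h: "h \<in> carrier_vec n"
    and eq: "(l \<bullet> h)\<^sup>2 = (l \<bullet> l) * (h \<bullet> h)"
  shows "vec_space.rank n (outer_prod l h + outer_prod h l) \<le> 1"
proof -
  \<comment> \<open>For nonzero \<open>l\<close>, the vector \<open>t l\<close> is the orthogonal
    projection of \<open>h\<close> onto the line of \<open>l\<close>.\<close>
  define t where "t = (l \<bullet> h) / (l \<bullet> l)"
  have sp: "u \<bullet> v = (\<Sum>i<n. u $ i * v $ i)" if "v \<in> carrier_vec n" for u v :: "real vec"
    using that by (simp add: scalar_prod_def lessThan_atLeast0)
  have "\<exists>c. \<forall>i<n. \<forall>j<n. l $ i * h $ j + h $ i * l $ j = c * l $ i * l $ j"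
  proof (cases "l \<bullet> l = 0")
    case True
    then have "\<forall>i<n. l $ i = 0"
      by (auto simp: sp l sum_nonneg_eq_0_iff)
    then show ?thesis by auto
  next
    case False
    \<comment> \<open>This is the squared distance from \<open>h\<close> to its projection;
      \<open>eq\<close> makes it vanish, hence every summand does.\<close>
    have "(\<Sum>i<n. (h $ i - t * l $ i)\<^sup>2) = h \<bullet> h - 2 * t * (l \<bullet> h) + t\<^sup>2 * (l \<bullet> l)"
      unfolding sp[OF l] sp[OF h] sum_distrib_left sum_subtractf[symmetric] sum.distrib[symmetric]
      by (rule sum.cong) (auto simp: power2_eq_square algebra_simps)
    also have "\<dots> = 0"
      using False eq by (simp add: t_def field_simps power2_eq_square)
    finally have "\<forall>i<n. h $ i = t * l $ i"
      by (auto simp: sum_nonneg_eq_0_iff)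
    then show ?thesis by (intro exI[of _ "2 * t"]) (auto simp: algebra_simps)
  qed
  then obtain c where "\<forall>i<n. \<forall>j<n. l $ i * h $ j + h $ i * l $ j = c * l $ i * l $ j" ..
  then show ?thesis
    using l h outer_prod_carrier[OF l h] outer_prod_carrier[OF h l]
    by (intro vec_space.rank_le_1_product_entries[where nc = n and f = "\<lambda>i. c * l $ i" and g = "\<lambda>j. l $ j"])
      (auto simp: index_sym_outer_prod[OF l h])
qed

text \<open>Rotating each coordinate pair \<open>(i, n + i)\<close> by \<open>-x $ i\<close>
  conjugates \<open>diag(L, L)\<close> into the block matrix, by the addition formulas for sine and
  cosine. Symmetry of \<open>L\<close> is what turns the lower left block into the transpose of
  \<open>B\<close>.\<close>

lemma char_poly_rotated_blocks:
  fixes L :: "real mat" and x :: "real vec"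
  assumes L: "L \<in> carrier_mat n n" and sym: "\<And>i j. i < n \<Longrightarrow> j < n \<Longrightarrow> L $$ (i, j) = L $$ (j, i)"
    and A: "A = mat n n (\<lambda>(i, j). L $$ (i, j) * cos (x $ i - x $ j))"
    and B: "B = mat n n (\<lambda>(i, j). L $$ (i, j) * sin (x $ i - x $ j))"
  shows "char_poly (four_block_mat A B B\<^sup>T A) = (char_poly L)\<^sup>2"
proof -
  define C where "C = mat_diag n (\<lambda>i. cos (x $ i))"
  define S where "S = mat_diag n (\<lambda>i. sin (x $ i))"
  \<comment> \<open>Writing \<open>-S\<close> as a diagonal matrix of its own lets the product rules
    for \<open>mat_diag\<close> apply to it. Then \<open>?R\<close> is the transpose of the
    orthogonal matrix \<open>?Q\<close>.\<close>
  define S' where "S' = mat_diag n (\<lambda>i. - sin (x $ i))"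
  have carr [simp]: "C \<in> carrier_mat n n" "S \<in> carrier_mat n n" "S' \<in> carrier_mat n n"
    by (auto simp: C_def S_def S'_def)
  note [simp] = L
  let ?D = "four_block_mat L (0\<^sub>m n n) (0\<^sub>m n n) L"
  let ?Q = "four_block_mat C S S' C"
  let ?R = "four_block_mat C S' S C"
  note mult = mult_four_block_mat[where ?nr1.0 = n and ?n1.0 = n and ?n2.0 = n and ?nr2.0 = n
      and ?nc1.0 = n and ?nc2.0 = n]
  have CS: "C * C + S * S = 1\<^sub>m n" "S * S + C * C = 1\<^sub>m n"
      "C * C + S' * S' = 1\<^sub>m n" "S' * S' + C * C = 1\<^sub>m n"
      "C * S' + S * C = 0\<^sub>m n n" "S' * C + C * S = 0\<^sub>m n n"
      "C * S + S' * C = 0\<^sub>m n n" "S * C + C * S' = 0\<^sub>m n n"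
    unfolding C_def S_def S'_def mat_diag_diag
    by (rule eq_matI; simp add: mat_diag_def mult.commute
        trans[OF add.commute sin_cos_squared_add3])+
  have QR: "?Q * ?R = 1\<^sub>m (n + n)" and RQ: "?R * ?Q = 1\<^sub>m (n + n)"
    by (subst mult; simp add: CS)+
  have CL: "C * L \<in> carrier_mat n n" "S * L \<in> carrier_mat n n" "S' * L \<in> carrier_mat n n"
    by (rule mult_carrier_mat[where n = n]; simp)+
  have zero: "M * 0\<^sub>m n n = 0\<^sub>m n n" if "M \<in> carrier_mat n n" for M :: "real mat"
    using that by simp
  have "?Q * ?D = four_block_mat (C * L) (S * L) (S' * L) (C * L)"
    by (subst mult) (use CL in \<open>auto simp: zero\<close>)
  also have "\<dots> * ?R = four_block_mat (C * L * C + S * L * S) (C * L * S' + S * L * C)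
      (S' * L * C + C * L * S) (S' * L * S' + C * L * C)"
    by (subst mult) (use CL in auto)
  also have "\<dots> = four_block_mat A B B\<^sup>T A"
    by (intro arg_cong4[where f = four_block_mat])
      (auto intro!: eq_matI simp: A B C_def S_def S'_def sym cos_diff sin_diff algebra_simps
        mat_diag_mult_left[where nr = n] mat_diag_mult_right[where nr = n])
  finally have P: "four_block_mat A B B\<^sup>T A = ?Q * ?D * ?R" ..
  have "A \<in> carrier_mat n n"
    by (simp add: A)
  then have "similar_mat_wit (four_block_mat A B B\<^sup>T A) ?D ?Q ?R"
    by (intro similar_mat_witI[OF QR RQ P]) simp_all
  then have "char_poly (four_block_mat A B B\<^sup>T A) = char_poly ?D"
    by (intro char_poly_similar) (unfold similar_mat_def, blast)
  also have "\<dots> = (char_poly L)\<^sup>2"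
    by (simp add: char_poly_four_block_lower_left_zero[where n = n and m = n] power2_eq_square)
  finally show ?thesis .
qed

theorem proposition5:
  fixes n :: nat
    and x l h :: "real vec"
    and L A B P :: "real mat"
    and \<gamma> \<delta> :: real
  assumes "n \<ge> 2"
    and "x \<in> carrier_vec n" and "l \<in> carrier_vec n" and "h \<in> carrier_vec n"
    and "L = outer_prod l h + outer_prod h l"
    and "A = mat n n (\<lambda>(i, j). L $$ (i, j) * cos (x $ i - x $ j))"
    and "B = mat n n (\<lambda>(i, j). L $$ (i, j) * sin (x $ i - x $ j))"
    and "P = four_block_mat A B B\<^sup>T A"
    and "\<gamma> = l \<bullet> h"
    and "\<delta> = sqrt ((l \<bullet> l) * (h \<bullet> h))"
    and "vec_space.rank n L = 2"
  shows "filter_mset (\<lambda>k. k \<noteq> 0) (eigenvalues_mset P) = {#\<gamma> + \<delta>, \<gamma> + \<delta>, \<gamma> - \<delta>, \<gamma> - \<delta>#}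
    \<and> count (eigenvalues_mset P) 0 = 2 * n - 4"
proof -
  have l: "l \<in> carrier_vec n" and h: "h \<in> carrier_vec n" by fact+
  have L: "L \<in> carrier_mat n n"
    using outer_prod_carrier[OF l h] outer_prod_carrier[OF h l] by (simp add: assms(5))
  have sym: "L $$ (i, j) = L $$ (j, i)" if "i < n" "j < n" for i j
    using that by (simp add: assms(5) index_sym_outer_prod[OF l h])
  define q where "q = [:0, 1:] ^ (n - 2) * ([:- (\<gamma> + \<delta>), 1:] * [:- (\<gamma> - \<delta>), 1:])"
  have "char_poly P = q\<^sup>2"
    using char_poly_rotated_blocks[OF L sym assms(6,7)] char_poly_sym_outer_prod[OF l h assms(1)]
    by (simp add: assms(5,8,9,10) q_def)
  \<comment> \<open>The linear factors must not be multiplied out, since the roots are read off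
    factor by factor.\<close>
  moreover have "proots q = replicate_mset (n - 2) 0 + {#\<gamma> + \<delta>, \<gamma> - \<delta>#}"
    unfolding q_def by (simp add: proots_mult proots_power del: mult_pCons_left mult_pCons_right)
  ultimately have ev: "eigenvalues_mset P =
      repeat_mset 2 (replicate_mset (n - 2) 0 + {#\<gamma> + \<delta>, \<gamma> - \<delta>#})"
    by (simp add: eigenvalues_mset_def proots_power)
  \<comment> \<open>Equality would be the equality case of Cauchy--Schwarz and force rank at most 1,
    against rank 2.\<close>
  have "\<gamma>\<^sup>2 \<noteq> \<delta>\<^sup>2"
    using rank_sym_outer_prod_le_1[OF l h] assms(11)
    by (auto simp: assms(5,9,10) scalar_prod_ge_0_real)
  then have nz: "\<gamma> + \<delta> \<noteq> 0" "\<gamma> - \<delta> \<noteq> 0"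
    by (auto simp: power2_eq_iff add_eq_0_iff)
  \<comment> \<open>As \<gamma> + \<delta> and \<gamma> - \<delta> are nonzero, the root 0 comes
    only from the doubled factor \<open>X^(n-2)\<close>.\<close>
  show ?thesis
  proof
    show "filter_mset (\<lambda>k. k \<noteq> 0) (eigenvalues_mset P) = {#\<gamma> + \<delta>, \<gamma> + \<delta>, \<gamma> - \<delta>, \<gamma> - \<delta>#}"
      unfolding ev using nz by (intro multiset_eqI) auto
    show "count (eigenvalues_mset P) 0 = 2 * n - 4"
      unfolding ev using nz by simp
  qed
qed

end
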